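(* Let $K\ge 3$ and let $P\subset\mathbb{R}^2$ be any convex polygon with $K$ sides. Let $O_1,O_2,O_3$ be three random points in the feasible region of $P$ whose joint distribution is absolutely continuous with respect to Lebesgue measure. Put $d_{12}=\|O_1-O_2\|$ and $d_{23}=\|O_2-O_3\|$. Then, with probability $1$, the room shape and the measurement locations are determined, up to reflection, by the unlabeled first order echoes at $O_1,O_2,O_3$ together with $d_{12}$ and $d_{23}$ (the turning angle $\varphi\in(0,2\pi)$ at $O_2$ being unknown). Precisely, with probability $1$ the following holds. Let $P'$ be a convex polygon with $K$ sides and let $O_3'\in\mathbb{R}^2$ be a point such that, writing $O_1'=O_1$ and $O_2'=O_2$: (i) $O_1',O_2',O_3'$ all lie in the feasible region of $P'$; (ii) $\|O_2'-O_3'\|=d_{23}$; (iii) for each $j\in\{1,2,3\}$, the multiset of the $K$ distances from $O_j'$ to the walls of $P'$ equals the multiset of the $K$ distances from $O_j$ to the walls of $P$. Then either $(P',O_3')=(P,O_3)$, or $(P',O_3')=(\rho(P),\rho(O_3))$, where $\rho$ is the reflection of the plane across the line through $O_1$ and $O_2$.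
   Context: A room is a convex planar polygon $P$ with $K$ sides, called walls. A point $O$ inside $P$ is feasible (for $P$) if a co-located loudspeaker/microphone at $O$ receives a first order echo from every wall, i.e. for every wall the foot of the perpendicular from $O$ to the line containing that wall lies on the wall itself. The feasible region of $P$ is the set of all feasible points. The first order echo at a feasible point $O$ from a wall is (equivalent to) the distance from $O$ to the line containing that wall. Echoes are unlabeled (ungrouped): at each measurement point only the multiset of the $K$ distances is available, and it is not known which distance corresponds to which wall. A mobile device visits $O_1,O_2,O_3$ successively. The path lengths $d_{12},d_{23}$ are known, while the turning angle $\varphi=\pi-\angle O_1O_2O_3$ (equivalently, the distance between $O_1$ and $O_3$) is not. The coordinate frame is fixed by taking $O_1$ as the origin and $O_2$ on the positive $x$-axis. "SLAM" (simultaneous localization and mapping) means recovering the polygon $P$ and the position of $O_3$ in this frame. *)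

theory Defs
  imports "HOL-Probability.Probability"
begin

definition walls :: "(real^2) set \<Rightarrow> (real^2) set set" where
  "walls P = {w. w facet_of P}"

definition convex_polygon :: "nat \<Rightarrow> (real^2) set \<Rightarrow> bool" where
  "convex_polygon K P \<longleftrightarrow> polytope P \<and> aff_dim P = 2 \<and> card (walls P) = K"

definition is_foot :: "real^2 \<Rightarrow> real^2 \<Rightarrow> (real^2) set \<Rightarrow> bool" where
  "is_foot q x L \<longleftrightarrow> q \<in> L \<and> (\<forall>y\<in>L. orthogonal (x - q) (y - q))"

text \<open>The line containing a wall is its affine hull.\<close>

definition feasible_region :: "(real^2) set \<Rightarrow> (real^2) set" where
  "feasible_region P =
     {x \<in> interior P. \<forall>w \<in> walls P. \<exists>q \<in> w. is_foot q x (affine hull w)}"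

definition echoes :: "(real^2) set \<Rightarrow> real^2 \<Rightarrow> real multiset" where
  "echoes P x = image_mset (\<lambda>w. infdist x (affine hull w)) (mset_set (walls P))"

text \<open>Reflection across the line through \<open>a\<close> and \<open>b\<close>: \<open>x\<close> is mapped to \<open>2 q - x\<close>, where \<open>q\<close> is
  the foot of the perpendicular from \<open>x\<close> to that line. Only meaningful for \<open>a \<noteq> b\<close>.\<close>

definition line_reflection :: "real^2 \<Rightarrow> real^2 \<Rightarrow> real^2 \<Rightarrow> real^2" where
  "line_reflection a b x =
     2 *\<^sub>R (a + (((x - a) \<bullet> (b - a)) / ((b - a) \<bullet> (b - a))) *\<^sub>R (b - a)) - x"

end

theory Submission
  imports Defs
begin

text \<open>
  Write \<open>n\<^sub>k\<close> for the unit outer normals of \<open>P\<close>, \<open>w = O\<^sub>2 - O\<^sub>1\<close> and \<open>u = O\<^sub>3 - O\<^sub>2\<close>. A competing room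
  \<open>P'\<close> with step \<open>v = O\<^sub>3' - O\<^sub>2\<close> labels its walls by those of \<open>P\<close> through the echoes at \<open>O\<^sub>1\<close>; the
  echoes at \<open>O\<^sub>2\<close> and \<open>O\<^sub>3'\<close> then give maps \<open>\<sigma>\<close>, \<open>\<tau>\<close> of the walls to themselves. The inner product of
  the normal \<open>m\<^sub>k\<close> of \<open>P'\<close> with \<open>w\<close> is a difference of echoes, so given \<open>O\<^sub>1\<close>, \<open>O\<^sub>2\<close> there are finitely many
  candidates for the family \<open>m\<close>. For each of them the differences of the echoes at \<open>O\<^sub>2\<close> and \<open>O\<^sub>3'\<close>
  make \<open>v\<close> an affine function \<open>A u + d\<close>. If the remaining equations, including \<open>norm v = norm u\<close>,
  hold on a non-null set of \<open>u\<close>, they hold identically: \<open>d = 0\<close>, \<open>A\<close> is orthogonal, \<open>\<sigma> = \<tau>\<close> and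
  \<open>m\<^sub>k = A n\<^sub>\<sigma>\<^sub>k\<close>. With \<open>w = A w\<^sub>0\<close>, the vector \<open>z = w\<^sub>0 - w\<close> solves a linear system that depends on
  \<open>O\<^sub>1\<close> only, and \<open>norm (w + z) = norm w\<close>; for generic \<open>O\<^sub>2\<close> this forces \<open>z = 0\<close>, hence \<open>\<sigma> = id\<close> and
  \<open>A w = w\<close>, so \<open>A\<close> is the identity or the reflection that fixes \<open>w\<close>.
\<close>

section \<open>Polyhedra as intersections of facet half-spaces\<close>

text \<open>The foot of the perpendicular gives one bound and Cauchy-Schwarz the other. On the
  room's side of a wall the echo is therefore affine in the position, which makes the echo equations
  linear.\<close>

lemma infdist_hyperplane_of_le:
  fixes a x :: "'a::euclidean_space"
  assumes "norm a = 1" "a \<bullet> x \<le> b"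
  shows "infdist x {y. a \<bullet> y = b} = b - a \<bullet> x"
proof (rule antisym)
  have aa: "a \<bullet> a = 1" using assms(1) by (simp add: dot_square_norm)
  have "x + (b - a \<bullet> x) *\<^sub>R a \<in> {y. a \<bullet> y = b}"
    by (simp add: inner_add_right aa)
  from infdist_le[OF this, of x] show "infdist x {y. a \<bullet> y = b} \<le> b - a \<bullet> x"
    using assms by (simp add: dist_norm)
  have "b - a \<bullet> x \<le> dist x y" if "y \<in> {y. a \<bullet> y = b}" for y
  proof -
    have "b - a \<bullet> x = a \<bullet> (y - x)" using that by (simp add: inner_diff_right)
    also have "\<dots> \<le> norm a * norm (y - x)" by (rule norm_cauchy_schwarz)
    finally show ?thesis using assms(1) by (simp add: dist_norm norm_minus_commute)
  qed
  then show "b - a \<bullet> x \<le> infdist x {y. a \<bullet> y = b}"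
    using \<open>x + (b - a \<bullet> x) *\<^sub>R a \<in> _\<close> unfolding infdist_def by (auto intro!: cINF_greatest)
qed

lemma affine_hull_facet_hyperplane:
  fixes S :: "'a::euclidean_space set"
  assumes "w facet_of S" "aff_dim S = DIM('a)" "w \<subseteq> {y. a \<bullet> y = b}" "a \<noteq> 0"
  shows "affine hull w = {y. a \<bullet> y = b}"
proof (rule affine_dim_equal)
  show "affine hull w \<subseteq> {y. a \<bullet> y = b}"
    by (rule hull_minimal) (use assms(3) in \<open>auto simp: affine_hyperplane\<close>)
  show "aff_dim (affine hull w) = aff_dim {y. a \<bullet> y = b}"
    using assms by (simp add: facet_of_def aff_dim_affine_hull)
qed (use assms in \<open>auto simp: facet_of_def affine_hyperplane\<close>)

text \<open>Each half-space \<open>h\<close> of a minimal representation cuts out a facet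
  \<open>w\<close>, so the inequality chosen for \<open>w\<close> bounds a half-space with the same
  boundary hyperplane as \<open>h\<close>. A segment argument from an interior point shows that no
  point outside \<open>h\<close> satisfies the chosen inequality.\<close>

lemma polyhedron_facet_representation:
  fixes S :: "'a::euclidean_space set"
  assumes "polyhedron S" "aff_dim S = DIM('a)"
  obtains a b where
    "\<forall>w. w facet_of S \<longrightarrow>
       norm (a w) = 1 \<and> w = S \<inter> {x. a w \<bullet> x = b w} \<and> affine hull w = {x. a w \<bullet> x = b w}"
    "\<forall>x. x \<in> S \<longleftrightarrow> (\<forall>w. w facet_of S \<longrightarrow> a w \<bullet> x \<le> b w)"
proof -
  have "\<exists>a b. norm a = 1 \<and> S \<subseteq> {x. a \<bullet> x \<le> b} \<and> w = S \<inter> {x. a \<bullet> x = b}" if "w facet_of S" for w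
  proof -
    obtain a b where ab: "a \<noteq> 0" "S \<subseteq> {x. a \<bullet> x \<le> b}" "w = S \<inter> {x. a \<bullet> x = b}"
      using facet_of_polyhedron[OF assms(1) \<open>w facet_of S\<close>] .
    have *: "(1 / norm a) *\<^sub>R a \<bullet> x \<le> b / norm a \<longleftrightarrow> a \<bullet> x \<le> b"
      "(1 / norm a) *\<^sub>R a \<bullet> x = b / norm a \<longleftrightarrow> a \<bullet> x = b" for x
      using ab(1) by (auto simp: field_simps)
    show ?thesis
      by (rule exI[of _ "(1 / norm a) *\<^sub>R a"], rule exI[of _ "b / norm a"], unfold *)
        (use ab in auto)
  qed
  then obtain a b where ab: "\<And>w. w facet_of S \<Longrightarrow>
      norm (a w) = 1 \<and> S \<subseteq> {x. a w \<bullet> x \<le> b w} \<and> w = S \<inter> {x. a w \<bullet> x = b w}"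
    by metis
  have hull: "affine hull w = {x. a w \<bullet> x = b w}" if "w facet_of S" for w
    using affine_hull_facet_hyperplane[OF that assms(2), of "a w" "b w"] ab[OF that] by fastforce
  have full: "affine hull S = UNIV" using assms(2) by (simp add: aff_dim_eq_full)
  then obtain x0 where x0: "x0 \<in> interior S"
    by (metis assms(1) aff_dim_empty all_not_in_conv assms(2) empty_iff interior_rel_interior_gen
        of_nat_neq_0 polyhedron_imp_convex rel_interior_eq_empty affine_hull_empty UNIV_I)
  obtain F where "finite F" and S: "S = affine hull S \<inter> \<Inter>F"
    and "\<forall>h\<in>F. \<exists>a b. a \<noteq> 0 \<and> h = {x. a \<bullet> x \<le> b}"
    and min: "\<And>F'. F' \<subset> F \<Longrightarrow> S \<subset> affine hull S \<inter> \<Inter>F'"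
    using assms(1) unfolding polyhedron_Int_affine_minimal by meson
  then obtain p q where pq: "\<And>h. h \<in> F \<Longrightarrow> p h \<noteq> 0 \<and> h = {x. p h \<bullet> x \<le> q h}"
    by metis
  have "y \<in> S" if y: "\<And>w. w facet_of S \<Longrightarrow> a w \<bullet> y \<le> b w" for y
  proof (rule ccontr)
    assume "y \<notin> S"
    then obtain h where h: "h \<in> F" "y \<notin> h" using S full by auto
    define w where "w = S \<inter> {x. p h \<bullet> x = q h}"
    have w: "w facet_of S"
      by (rule facet_of_polyhedron_explicit[OF \<open>finite F\<close> S pq min, THEN iffD2])
        (use h(1) in \<open>auto simp: w_def\<close>)
    have eq: "{x. a w \<bullet> x = b w} = {x. p h \<bullet> x = q h}"
      using hull[OF w] affine_hull_facet_hyperplane[OF w assms(2), of "p h" "q h"] pq[OF h(1)]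
      by (auto simp: w_def)
    have yq: "p h \<bullet> y > q h" using h pq[OF h(1)] by (smt (verit) mem_Collect_eq)
    have strict: "c \<bullet> x0 < d" if c: "c \<noteq> 0" and le: "S \<subseteq> {x. c \<bullet> x \<le> d}" for c d
    proof -
      have "interior S \<subseteq> interior {x. c \<bullet> x \<le> d}" by (rule interior_mono[OF le])
      then show ?thesis using x0 interior_halfspace_le[OF c] by auto
    qed
    have "S \<subseteq> h" using S h(1) by blast
    then have xq: "p h \<bullet> x0 < q h" using strict[of "p h" "q h"] pq[OF h(1)] by blast
    have xb: "a w \<bullet> x0 < b w" using strict[of "a w" "b w"] ab[OF w] by fastforce
    \<comment> \<open>This is the parameter at which the segment from \<open>x0\<close> to
      \<open>y\<close> crosses the common hyperplane. The inequality for \<open>w\<close> is strict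
      at \<open>x0\<close> and weak at \<open>y\<close>, so it would be strict at the crossing
      too.\<close>
    define t where "t = (q h - p h \<bullet> x0) / (p h \<bullet> y - p h \<bullet> x0)"
    have t: "0 < t" "t < 1" using xq yq by (auto simp: t_def field_simps)
    have "p h \<bullet> (x0 + t *\<^sub>R (y - x0)) = q h"
      using xq yq by (simp add: t_def inner_add_right inner_diff_right)
    then have "a w \<bullet> (x0 + t *\<^sub>R (y - x0)) = b w" using eq by blast
    then have "(1 - t) * (a w \<bullet> x0) + t * (a w \<bullet> y) = b w"
      by (simp add: inner_add_right inner_diff_right algebra_simps)
    moreover have "(1 - t) * (a w \<bullet> x0) < (1 - t) * b w" using xb t by simp
    moreover have "t * (a w \<bullet> y) \<le> t * b w" using y[OF w] t by simp
    ultimately show False by (simp add: algebra_simps)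
  qed
  then have "\<forall>x. x \<in> S \<longleftrightarrow> (\<forall>w. w facet_of S \<longrightarrow> a w \<bullet> x \<le> b w)"
    using ab by blast
  moreover have "\<forall>w. w facet_of S \<longrightarrow>
       norm (a w) = 1 \<and> w = S \<inter> {x. a w \<bullet> x = b w} \<and> affine hull w = {x. a w \<bullet> x = b w}"
    using ab hull by blast
  ultimately show thesis using that by blast
qed

text \<open>A nonzero vector orthogonal to all normals would be the direction of a whole line inside
  the bounded set.\<close>

lemma bounded_halfspaces_normals_span:
  fixes n :: "'b \<Rightarrow> 'a::euclidean_space"
  assumes "bounded {x. \<forall>k\<in>W. n k \<bullet> x \<le> c k}" "\<And>k. k \<in> W \<Longrightarrow> n k \<bullet> x0 \<le> c k"
    and "\<And>k. k \<in> W \<Longrightarrow> n k \<bullet> z = 0"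
  shows "z = 0"
proof (rule ccontr)
  assume "z \<noteq> 0"
  obtain B where B: "\<And>x. (\<forall>k\<in>W. n k \<bullet> x \<le> c k) \<Longrightarrow> norm x \<le> B"
    using assms(1) by (auto simp: bounded_iff)
  have "norm (x0 + t *\<^sub>R z) \<le> B" for t
    by (rule B) (use assms(2,3) in \<open>auto simp: inner_add_right\<close>)
  from this[of "(\<bar>B\<bar> + norm x0 + 1) / norm z"]
  have "norm (((\<bar>B\<bar> + norm x0 + 1) / norm z) *\<^sub>R z) \<le> B + norm x0"
    by (smt (verit) add.commute norm_add_leD)
  then show False using \<open>z \<noteq> 0\<close> by simp
qed

section \<open>Null sets\<close>

text \<open>By Fubini and translation invariance, some translate of the exceptional set along \<open>e\<close> is null.\<close>

lemma AE_lborel_if_countable_on_lines: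
  fixes e :: "'a::euclidean_space"
  assumes meas: "Measurable.pred borel Q"
    and cnt: "\<And>x. countable {t. \<not> Q (x + t *\<^sub>R e)}"
  shows "AE x in lborel. Q x"
proof -
  have "(\<lambda>p :: 'a \<times> real. fst p + snd p *\<^sub>R e) \<in> borel_measurable borel"
    by (intro borel_measurable_continuous_onI continuous_intros)
  from measurable_compose[OF this meas]
  have meas': "Measurable.pred (lborel \<Otimes>\<^sub>M lborel) (\<lambda>p. Q (fst p + snd p *\<^sub>R e))"
    by (simp add: lborel_prod)
  have "AE x in lborel. AE t in lborel. Q (x + t *\<^sub>R e)"
    by (intro AE_I2 AE_I'[OF countable_imp_null_set_lborel[OF cnt]]) auto
  then have "AE t in lborel. AE x in lborel. Q (x + t *\<^sub>R e)"
    by (subst (asm) lborel_pair.AE_commute) (use meas' in \<open>simp_all only: pred_def\<close>)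
  then have "\<exists>t. AE x in lborel. Q (x + t *\<^sub>R e)"
    by (rule eventually_happens'[rotated]) (simp add: ae_filter_eq_bot_iff)
  then obtain t where t: "AE x in lborel. Q (t *\<^sub>R e + x)" by (auto simp: add.commute)
  have "AE x in distr lborel borel ((+) (t *\<^sub>R e)). Q x"
    using t meas by (subst AE_distr_iff) (auto simp: pred_def)
  then show ?thesis unfolding lborel_distr_plus .
qed

lemma AE_lborel_translate:
  fixes p :: "'a::euclidean_space"
  assumes "AE u in lborel. Q u"
  shows "AE x in lborel. Q (x - p)"
proof -
  have "AE u in distr lborel borel ((+) (- p)). Q u"
    using assms by (simp only: lborel_distr_plus)
  then have "AE x in lborel. Q (- p + x)"
    by (rule AE_distrD[rotated]) simp
  then show ?thesis by simp
qed

text \<open>If \<open>f\<close> is not zero, pick \<open>e\<close> with \<open>f e\<close> nonzero: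
  each line in direction \<open>e\<close> meets the level set exactly once.\<close>

lemma AE_lborel_linear_neq:
  fixes f :: "'a::euclidean_space \<Rightarrow> real"
  assumes f: "linear f" and ne: "\<not> (\<forall>u. f u = \<delta>)"
  shows "AE u in lborel. f u \<noteq> \<delta>"
proof (cases "\<forall>u. f u = 0")
  case True
  with ne show ?thesis by auto
next
  case False
  then obtain e where e: "f e \<noteq> 0" by auto
  have [measurable]: "f \<in> borel_measurable borel"
    by (rule borel_measurable_continuous_onI, rule linear_continuous_on)
      (use f in \<open>simp add: linear_conv_bounded_linear\<close>)
  show ?thesis
  proof (rule AE_lborel_if_countable_on_lines)
    show "Measurable.pred borel (\<lambda>u. f u \<noteq> \<delta>)" by measurable
    fix x
    have "{t. \<not> f (x + t *\<^sub>R e) \<noteq> \<delta>} \<subseteq> {(\<delta> - f x) / f e}"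
      using e by (auto simp: linear_add[OF f] linear_cmul[OF f] field_simps)
    then show "countable {t. \<not> f (x + t *\<^sub>R e) \<noteq> \<delta>}"
      by (rule countable_subset) simp
  qed
qed

text \<open>On a line with direction \<open>e\<close>, equality of the squared norms is a polynomial
  equation in the parameter. If \<open>A\<close> is no isometry, some \<open>e\<close> makes the
  quadratic coefficient nonzero; otherwise \<open>d\<close> is nonzero, and \<open>A e = d\<close>
  makes the equation linear with slope \<open>2 * (d \<bullet> d)\<close>.\<close>

lemma AE_lborel_norm_affine_neq:
  fixes A :: "'a::euclidean_space \<Rightarrow> 'a"
  assumes A: "linear A" and ne: "\<not> (d = 0 \<and> orthogonal_transformation A)"
  shows "AE u in lborel. norm (A u + d) \<noteq> norm u"
proof -
  have [measurable]: "A \<in> borel_measurable borel"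
    by (rule borel_measurable_continuous_onI, rule linear_continuous_on)
      (use A in \<open>simp add: linear_conv_bounded_linear\<close>)
  have meas: "Measurable.pred borel (\<lambda>u. norm (A u + d) \<noteq> norm u)" by measurable
  show ?thesis
  proof (cases "\<forall>u. norm (A u) = norm u")
    case False
    then obtain e where e: "norm (A e) \<noteq> norm e" by auto
    show ?thesis
    proof (rule AE_lborel_if_countable_on_lines[OF meas])
      fix x
      define p where "p = [:(A x + d) \<bullet> (A x + d) - x \<bullet> x, 2 * ((A x + d) \<bullet> A e - x \<bullet> e), A e \<bullet> A e - e \<bullet> e:]"
      have "A e \<bullet> A e \<noteq> e \<bullet> e" using e by (simp add: norm_eq)
      then have "p \<noteq> 0" by (simp add: p_def)
      have "poly p t = 0" if "norm (A (x + t *\<^sub>R e) + d) = norm (x + t *\<^sub>R e)" for t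
      proof -
        have "(A (x + t *\<^sub>R e) + d) \<bullet> (A (x + t *\<^sub>R e) + d) = (x + t *\<^sub>R e) \<bullet> (x + t *\<^sub>R e)"
          using that by (simp add: norm_eq)
        then show ?thesis
          by (simp add: p_def linear_add[OF A] linear_cmul[OF A] inner_add_left inner_add_right
              inner_commute algebra_simps)
      qed
      then have "{t. \<not> norm (A (x + t *\<^sub>R e) + d) \<noteq> norm (x + t *\<^sub>R e)} \<subseteq> {t. poly p t = 0}"
        by auto
      with poly_roots_finite[OF \<open>p \<noteq> 0\<close>]
      show "countable {t. \<not> norm (A (x + t *\<^sub>R e) + d) \<noteq> norm (x + t *\<^sub>R e)}"
        by (meson countable_finite finite_subset)
    qed
  next
    case True
    then have orth: "orthogonal_transformation A"
      using A by (simp add: orthogonal_transformation)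
    then have "d \<noteq> 0" using ne by simp
    obtain e where e: "A e = d"
      using orthogonal_transformation_surj[OF orth] by (metis surjD)
    show ?thesis
    proof (rule AE_lborel_if_countable_on_lines[OF meas])
      fix x
      have "t = (- (d \<bullet> d) / 2 - A x \<bullet> d) / (d \<bullet> d)"
        if "norm (A (x + t *\<^sub>R e) + d) = norm (x + t *\<^sub>R e)" for t
      proof -
        have "norm (A (x + t *\<^sub>R e) + d) = norm (A (x + t *\<^sub>R e))" using that True by simp
        then have "2 * (A (x + t *\<^sub>R e) \<bullet> d) + d \<bullet> d = 0"
          by (simp add: norm_eq inner_add_left inner_add_right inner_commute)
        then show ?thesis using \<open>d \<noteq> 0\<close>
          by (simp add: linear_add[OF A] linear_cmul[OF A] inner_add_left e field_simps)
      qed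
      then have "{t. \<not> norm (A (x + t *\<^sub>R e) + d) \<noteq> norm (x + t *\<^sub>R e)}
          \<subseteq> {(- (d \<bullet> d) / 2 - A x \<bullet> d) / (d \<bullet> d)}" by blast
      then show "countable {t. \<not> norm (A (x + t *\<^sub>R e) + d) \<noteq> norm (x + t *\<^sub>R e)}"
        by (rule countable_subset) simp
    qed
  qed
qed

text \<open>Fubini yields a null set in the product from null sections only for a measurable
  predicate; this is the purpose of the measurability lemmas below.\<close>

lemma AE_lborel_triple:
  fixes Q :: "'a::euclidean_space \<times> 'b::euclidean_space \<times> 'c::euclidean_space \<Rightarrow> bool"
  assumes meas: "Measurable.pred borel Q"
    and ae: "AE a in lborel. AE b in lborel. AE x in lborel. Q (a, b, x)"
  shows "AE p in lborel. Q p"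
proof -
  have "AE q in lborel. Q (a, q)" if "AE b in lborel. AE x in lborel. Q (a, b, x)" for a
  proof -
    have "(\<lambda>q :: 'b \<times> 'c. (a, q)) \<in> borel_measurable borel"
      by (intro borel_measurable_continuous_onI continuous_intros)
    from measurable_compose[OF this meas]
    have "{q \<in> space (lborel \<Otimes>\<^sub>M lborel). Q (a, q)} \<in> sets (lborel \<Otimes>\<^sub>M lborel)"
      unfolding lborel_prod by (simp add: pred_def)
    from lborel_pair.AE_pair_measure[OF this] that show ?thesis
      unfolding lborel_prod by blast
  qed
  with ae have "AE a in lborel. AE q in lborel. Q (a, q)"
    by (auto elim: eventually_mono)
  moreover have "{p \<in> space (lborel \<Otimes>\<^sub>M lborel). Q p} \<in> sets (lborel \<Otimes>\<^sub>M lborel)"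
    using meas unfolding lborel_prod by (simp add: pred_def)
  ultimately show ?thesis
    using lborel_pair.AE_pair_measure[of Q] unfolding lborel_prod by blast
qed

section \<open>Plane vectors\<close>

definition quarter_turn :: "real^2 \<Rightarrow> real^2" where
  "quarter_turn x = vector [- x $ 2, x $ 1]"

text \<open>For nonzero \<open>w\<close> this fixes \<open>w\<close> and negates its orthogonal
  complement; in the plane it is the reflection across the line spanned by \<open>w\<close>.\<close>

definition reflect_along :: "'a::real_inner \<Rightarrow> 'a \<Rightarrow> 'a" where
  "reflect_along w x = (2 * (x \<bullet> w) / (w \<bullet> w)) *\<^sub>R w - x"

definition unit_with_inner :: "real \<Rightarrow> real \<Rightarrow> real^2 \<Rightarrow> real^2" where
  "unit_with_inner s f w =
     (1 / (w \<bullet> w)) *\<^sub>R (f *\<^sub>R w + (s * sqrt (w \<bullet> w - f\<^sup>2)) *\<^sub>R quarter_turn w)"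

text \<open>Cramer's rule for the system \<open>a \<bullet> x = \<alpha>\<close>,
  \<open>b \<bullet> x = \<beta>\<close>; the determinant is
  \<open>quarter_turn a \<bullet> b\<close>.\<close>

definition cramer2 :: "real^2 \<Rightarrow> real^2 \<Rightarrow> real \<Rightarrow> real \<Rightarrow> real^2" where
  "cramer2 a b \<alpha> \<beta> =
     (1 / (quarter_turn a \<bullet> b)) *\<^sub>R (\<beta> *\<^sub>R quarter_turn a - \<alpha> *\<^sub>R quarter_turn b)"

lemma inner_2: "x \<bullet> y = x $ 1 * y $ 1 + x $ 2 * y $ 2" for x y :: "real^2"
  by (simp add: inner_vec_def sum_2)

lemma quarter_turn_component [simp]: "quarter_turn x $ 1 = - x $ 2" "quarter_turn x $ 2 = x $ 1"
  by (simp_all add: quarter_turn_def)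

lemma linear_quarter_turn: "linear quarter_turn"
  by (rule linearI) (simp_all add: vec_eq_iff forall_2)

lemma quarter_turn_expansion:
  assumes "w \<noteq> 0"
  shows "x = ((x \<bullet> w) / (w \<bullet> w)) *\<^sub>R w + ((x \<bullet> quarter_turn w) / (w \<bullet> w)) *\<^sub>R quarter_turn w"
proof -
  have "(w \<bullet> w) *\<^sub>R x = (x \<bullet> w) *\<^sub>R w + (x \<bullet> quarter_turn w) *\<^sub>R quarter_turn w"
    by (simp add: vec_eq_iff forall_2 inner_2 algebra_simps)
  then have "(1 / (w \<bullet> w)) *\<^sub>R (w \<bullet> w) *\<^sub>R x =
      (1 / (w \<bullet> w)) *\<^sub>R ((x \<bullet> w) *\<^sub>R w + (x \<bullet> quarter_turn w) *\<^sub>R quarter_turn w)" by (rule arg_cong)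
  then show ?thesis using assms by (simp add: scaleR_add_right)
qed

lemma inner_mult_inner_2:
  "(w \<bullet> w) * (x \<bullet> x) = (x \<bullet> w)\<^sup>2 + (x \<bullet> quarter_turn w)\<^sup>2"
  by (simp add: inner_2 power2_eq_square algebra_simps)

text \<open>By Pythagoras the component of \<open>m\<close> along \<open>quarter_turn w\<close> is
  known up to sign.\<close>

lemma unit_with_inner_exhaust:
  assumes "w \<noteq> 0" "norm m = 1" "m \<bullet> w = f"
  shows "\<exists>s\<in>{1, -1}. m = unit_with_inner s f w"
proof -
  have "m \<bullet> m = 1" using assms(2) by (simp add: dot_square_norm)
  then have "w \<bullet> w - f\<^sup>2 = (m \<bullet> quarter_turn w)\<^sup>2"
    using inner_mult_inner_2[of w m] assms(3) by simp
  then have "sqrt (w \<bullet> w - f\<^sup>2) = \<bar>m \<bullet> quarter_turn w\<bar>" by simp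
  then have "\<exists>s\<in>{1, -1}. m \<bullet> quarter_turn w = s * sqrt (w \<bullet> w - f\<^sup>2)"
    by (simp add: abs_if)
  then show ?thesis
    using quarter_turn_expansion[OF assms(1), of m] assms(3)
    by (auto simp: unit_with_inner_def scaleR_add_right)
qed

lemma inner_unit_with_inner:
  assumes "w \<noteq> 0"
  shows "unit_with_inner s f w \<bullet> w = f"
proof -
  have "quarter_turn w \<bullet> w = 0" by (simp add: inner_2)
  with assms show ?thesis by (simp add: unit_with_inner_def inner_add_left)
qed

lemma cramer2_unique:
  assumes "quarter_turn a \<bullet> b \<noteq> 0" "a \<bullet> x = \<alpha>" "b \<bullet> x = \<beta>"
  shows "x = cramer2 a b \<alpha> \<beta>"
proof -
  have "(quarter_turn a \<bullet> b) *\<^sub>R x = (b \<bullet> x) *\<^sub>R quarter_turn a - (a \<bullet> x) *\<^sub>R quarter_turn b"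
    by (simp add: vec_eq_iff forall_2 inner_2 algebra_simps)
  then have "(1 / (quarter_turn a \<bullet> b)) *\<^sub>R (quarter_turn a \<bullet> b) *\<^sub>R x = cramer2 a b \<alpha> \<beta>"
    by (simp add: cramer2_def assms(2,3))
  then show ?thesis using assms(1) by simp
qed

lemma cramer2_affine:
  "cramer2 a b (\<alpha> + \<alpha>') (\<beta> + \<beta>') = cramer2 a b \<alpha> \<beta> + cramer2 a b \<alpha>' \<beta>'"
  "cramer2 a b (t * \<alpha>) (t * \<beta>) = t *\<^sub>R cramer2 a b \<alpha> \<beta>"
  unfolding cramer2_def by (simp_all add: algebra_simps)

lemma reflect_along_involution: "reflect_along w (reflect_along w x) = x"
  by (cases "w = 0") (simp_all add: reflect_along_def inner_diff_left algebra_simps)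

lemma reflect_along_inner: "reflect_along w x \<bullet> y = x \<bullet> reflect_along w y"
  by (simp add: reflect_along_def inner_diff_left inner_diff_right inner_commute)

lemma reflect_along_self: "reflect_along w w = w"
  by (cases "w = 0") (simp_all add: reflect_along_def scaleR_2)

lemma linear_reflect_along: "linear (reflect_along w)"
  by (rule linearI)
    (simp_all add: reflect_along_def inner_add_left add_divide_distrib algebra_simps)

lemma line_reflection_eq: "line_reflection a b x = a + reflect_along (b - a) (x - a)"
  by (simp add: line_reflection_def reflect_along_def algebra_simps scaleR_2)

text \<open>The image of \<open>quarter_turn w\<close> is again orthogonal to \<open>w\<close> and
  of the same length, hence plus or minus \<open>quarter_turn w\<close>; together with
  \<open>w\<close> this vector spans the plane.\<close>

lemma orthogonal_transformation_2_fixing: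
  fixes A :: "real^2 \<Rightarrow> real^2"
  assumes A: "orthogonal_transformation A" and w: "A w = w" "w \<noteq> 0"
  shows "(\<forall>x. A x = x) \<or> (\<forall>x. A x = reflect_along w x)"
proof -
  let ?J = "quarter_turn w"
  have lin: "linear A" and inn: "\<And>x y. A x \<bullet> A y = x \<bullet> y"
    using A by (auto simp: orthogonal_transformation_def)
  have ww: "w \<bullet> w \<noteq> 0" using w(2) by simp
  have JJ: "?J \<bullet> ?J = w \<bullet> w" "?J \<bullet> w = 0" by (simp_all add: inner_2)
  have 0: "A ?J \<bullet> w = 0" using inn[of ?J w] w JJ by simp
  have "A ?J \<bullet> A ?J = w \<bullet> w" using inn[of ?J ?J] JJ by simp
  then have "(A ?J \<bullet> ?J)\<^sup>2 = (w \<bullet> w)\<^sup>2"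
    using inner_mult_inner_2[of w "A ?J"] 0 by (simp add: power2_eq_square)
  then have "A ?J \<bullet> ?J = w \<bullet> w \<or> A ?J \<bullet> ?J = - (w \<bullet> w)" by (simp add: power2_eq_iff)
  then have "A ?J = ?J \<or> A ?J = - ?J"
    using quarter_turn_expansion[OF w(2), of "A ?J"] 0 ww by auto
  moreover have Ax: "A x = ((x \<bullet> w) / (w \<bullet> w)) *\<^sub>R w + ((x \<bullet> ?J) / (w \<bullet> w)) *\<^sub>R A ?J" for x
    by (subst quarter_turn_expansion[OF w(2), of x])
      (simp add: linear_add[OF lin] linear_cmul[OF lin] w(1))
  moreover have Rx: "reflect_along w x = ((x \<bullet> w) / (w \<bullet> w)) *\<^sub>R w - ((x \<bullet> ?J) / (w \<bullet> w)) *\<^sub>R ?J" for x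
  proof -
    define p where "p = ((x \<bullet> w) / (w \<bullet> w)) *\<^sub>R w"
    define q where "q = ((x \<bullet> ?J) / (w \<bullet> w)) *\<^sub>R ?J"
    have x: "x = p + q"
      unfolding p_def q_def by (rule quarter_turn_expansion[OF w(2)])
    have "(2 * (x \<bullet> w) / (w \<bullet> w)) *\<^sub>R w = p + p"
      unfolding p_def by (simp flip: scaleR_left.add)
    moreover have "p + p - (p + q) = p - q" by simp
    ultimately have "reflect_along w x = p - q"
      using x by (simp only: reflect_along_def)
    then show ?thesis by (simp only: p_def q_def)
  qed
  ultimately consider (id) "A ?J = ?J" | (refl) "A ?J = - ?J" by blast
  then show ?thesis
  proof cases
    case id
    have "A x = x" for x
      unfolding Ax[of x] id by (rule quarter_turn_expansion[OF w(2), symmetric])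
    then show ?thesis by blast
  next
    case refl
    have "A x = reflect_along w x" for x
      unfolding Ax[of x] Rx[of x] refl by simp
    then show ?thesis by blast
  qed
qed

section \<open>Measurability of the plane constructions\<close>

lemma pred_eq:
  fixes f g :: "'a \<Rightarrow> 'b::{second_countable_topology, t2_space}"
  assumes "f \<in> borel_measurable M" "g \<in> borel_measurable M"
  shows "Measurable.pred M (\<lambda>x. f x = g x)"
  using measurable_equality_set[OF assms] by (simp add: pred_def)

lemma measurable_quarter_turn [measurable (raw)]:
  "f \<in> borel_measurable M \<Longrightarrow> (\<lambda>x. quarter_turn (f x)) \<in> borel_measurable M"
  by (rule measurable_compose[of f M borel], assumption, rule borel_measurable_continuous_onI,
      rule linear_continuous_on) (simp add: linear_quarter_turn flip: linear_conv_bounded_linear)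

lemma measurable_reflect_along [measurable (raw)]:
  fixes f g :: "'a \<Rightarrow> 'b::euclidean_space"
  assumes [measurable]: "f \<in> borel_measurable M" "g \<in> borel_measurable M"
  shows "(\<lambda>x. reflect_along (f x) (g x)) \<in> borel_measurable M"
  unfolding reflect_along_def by measurable

lemma measurable_unit_with_inner [measurable (raw)]:
  assumes [measurable]: "f \<in> borel_measurable M" "g \<in> borel_measurable M"
  shows "(\<lambda>x. unit_with_inner s (f x) (g x)) \<in> borel_measurable M"
  unfolding unit_with_inner_def by measurable

lemma measurable_cramer2 [measurable (raw)]:
  assumes [measurable]: "f \<in> borel_measurable M" "g \<in> borel_measurable M"
    "\<alpha> \<in> borel_measurable M" "\<beta> \<in> borel_measurable M"
  shows "(\<lambda>x. cramer2 (f x) (g x) (\<alpha> x) (\<beta> x)) \<in> borel_measurable M"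
  unfolding cramer2_def by measurable

section \<open>Generic measurement points\<close>

text \<open>A room reduced to unit outer normals and offsets of its walls. The assumption
  \<open>n_span\<close> is what boundedness of the room contributes.\<close>

locale wall_system =
  fixes W :: "'b set" and n :: "'b \<Rightarrow> real^2" and c :: "'b \<Rightarrow> real"
  assumes finite_W: "finite W"
    and norm_n: "k \<in> W \<Longrightarrow> norm (n k) = 1"
    and inj_n_c: "inj_on (\<lambda>k. (n k, c k)) W"
    and n_span: "(\<And>k. k \<in> W \<Longrightarrow> n k \<bullet> z = 0) \<Longrightarrow> z = 0"
begin

text \<open>The signed distance to the line of wall \<open>k\<close>: it equals the echo at points
  of the room and is affine on the whole plane.\<close>

definition gap :: "real^2 \<Rightarrow> 'b \<Rightarrow> real" where
  "gap x k = c k - n k \<bullet> x"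

lemma gap_shift: "gap x k = gap y k - n k \<bullet> (x - y)"
  by (simp add: gap_def inner_diff_right)

text \<open>Equal gaps for two walls put \<open>x\<close> on a line, or on the empty set if the
  normals agree, since then the offsets differ.\<close>

lemma AE_inj_on_gap: "AE x in lborel. inj_on (gap x) W"
proof -
  have "AE x in lborel. \<forall>k\<in>W. \<forall>l\<in>W. k \<noteq> l \<longrightarrow> gap x k \<noteq> gap x l"
  proof (intro AE_finite_allI finite_W)
    fix k l assume kl: "k \<in> W" "l \<in> W"
    show "AE x in lborel. k \<noteq> l \<longrightarrow> gap x k \<noteq> gap x l"
    proof (cases "k = l")
      case False
      have "AE x in lborel. (n k - n l) \<bullet> x \<noteq> c k - c l"
      proof (rule AE_lborel_linear_neq)
        show "linear ((\<bullet>) (n k - n l))" by (simp add: bounded_linear.linear bounded_linear_inner_right)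
        show "\<not> (\<forall>u. (n k - n l) \<bullet> u = c k - c l)"
        proof
          assume *: "\<forall>u. (n k - n l) \<bullet> u = c k - c l"
          from *[rule_format, of 0] *[rule_format, of "n k - n l"] have "n k = n l \<and> c k = c l"
            by simp
          then show False using inj_n_c kl False by (auto dest: inj_onD)
        qed
      qed
      then show ?thesis by (rule eventually_mono) (auto simp: gap_def inner_diff_left)
    qed simp
  qed
  then show ?thesis by (rule eventually_mono) (auto simp: inj_on_def)
qed

text \<open>The vector \<open>z\<close> plays the role of \<open>w\<^sub>0 - w\<close>, where \<open>w = b - a\<close>.\<close>

definition rigid_for :: "real^2 \<Rightarrow> real^2 \<Rightarrow> ('b \<Rightarrow> 'b) \<Rightarrow> bool" where
  "rigid_for a b \<sigma> \<longleftrightarrow>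
     (\<forall>y. (\<forall>k\<in>W. n (\<sigma> k) \<bullet> y = 0) \<longrightarrow> y = 0) \<longrightarrow>
     (\<forall>z. norm (b - a + z) = norm (b - a) \<longrightarrow>
        (\<forall>k\<in>W. n (\<sigma> k) \<bullet> z = gap a k - gap a (\<sigma> k)) \<longrightarrow> (\<forall>k\<in>W. \<sigma> k = k))"

text \<open>When the permuted normals span, the linear system has at most one solution
  \<open>z\<close>, and \<open>z\<close> does not depend on \<open>b\<close>. If
  \<open>z = 0\<close>, injectivity of the gaps at \<open>a\<close> gives the identity; otherwise
  the norm equation confines \<open>b\<close> to a null set.\<close>

lemma AE_rigid_for:
  assumes inj: "inj_on (gap a) W" and \<sigma>: "\<sigma> \<in> W \<rightarrow> W"
  shows "AE b in lborel. rigid_for a b \<sigma>"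
proof (cases "(\<forall>y. (\<forall>k\<in>W. n (\<sigma> k) \<bullet> y = 0) \<longrightarrow> y = 0) \<and>
    (\<exists>z. \<forall>k\<in>W. n (\<sigma> k) \<bullet> z = gap a k - gap a (\<sigma> k))")
  case False
  then show ?thesis by (intro AE_I2) (unfold rigid_for_def, blast)
next
  case True
  then obtain z where span: "\<And>y. (\<forall>k\<in>W. n (\<sigma> k) \<bullet> y = 0) \<Longrightarrow> y = 0"
    and z: "\<forall>k\<in>W. n (\<sigma> k) \<bullet> z = gap a k - gap a (\<sigma> k)" by blast
  have uniq: "z' = z" if "\<forall>k\<in>W. n (\<sigma> k) \<bullet> z' = gap a k - gap a (\<sigma> k)" for z'
    using span[of "z' - z"] that z by (simp add: inner_diff_right)
  show ?thesis
  proof (cases "z = 0")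
    case True
    then have "\<forall>k\<in>W. \<sigma> k = k" using z inj \<sigma> by (auto simp: inj_on_def Pi_iff)
    then show ?thesis by (simp add: rigid_for_def)
  next
    case False
    have "AE u in lborel. norm (id u + z) \<noteq> norm u"
      by (rule AE_lborel_norm_affine_neq) (use False in \<open>auto simp: linear_ident\<close>)
    then have "AE b in lborel. norm (id (b - a) + z) \<noteq> norm (b - a)"
      by (rule AE_lborel_translate)
    then show ?thesis
      by (rule eventually_mono) (use uniq in \<open>auto simp: rigid_for_def\<close>)
  qed
qed

text \<open>
  \<open>\<sigma>\<close> and \<open>\<tau>\<close> tell which echoes at the second and third point belong to the same wall of the
  competing room as the echo \<open>k\<close> at the first one; the sign \<open>\<epsilon> k\<close> chooses between the two unit vectors
  with the prescribed inner product with \<open>b - a\<close>. The radicand in \<open>unit_with_inner\<close> may be negative;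
  the resulting non-unit vectors are harmless, as only the inner product with \<open>b - a\<close> is used.
\<close>

definition recon_normal :: "('b \<Rightarrow> 'b) \<Rightarrow> ('b \<Rightarrow> real) \<Rightarrow> real^2 \<Rightarrow> real^2 \<Rightarrow> 'b \<Rightarrow> real^2" where
  "recon_normal \<sigma> \<epsilon> a b k = unit_with_inner (\<epsilon> k) (gap a k - gap b (\<sigma> k)) (b - a)"

definition recon_step ::
  "('b \<Rightarrow> 'b) \<Rightarrow> ('b \<Rightarrow> 'b) \<Rightarrow> ('b \<Rightarrow> real) \<Rightarrow> 'b \<Rightarrow> 'b \<Rightarrow> real^2 \<Rightarrow> real^2 \<Rightarrow> real^2 \<Rightarrow> real^2" where
  "recon_step \<sigma> \<tau> \<epsilon> i j a b x =
     cramer2 (recon_normal \<sigma> \<epsilon> a b i) (recon_normal \<sigma> \<epsilon> a b j)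
       (gap b (\<sigma> i) - gap x (\<tau> i)) (gap b (\<sigma> j) - gap x (\<tau> j))"

definition genuine :: "('b \<Rightarrow> 'b) \<Rightarrow> ('b \<Rightarrow> 'b) \<Rightarrow> ('b \<Rightarrow> real) \<Rightarrow> real^2 \<Rightarrow> real^2 \<Rightarrow> bool" where
  "genuine \<sigma> \<tau> \<epsilon> a b \<longleftrightarrow> (\<forall>k\<in>W. \<sigma> k = k \<and> \<tau> k = k) \<and>
     ((\<forall>k\<in>W. recon_normal \<sigma> \<epsilon> a b k = n k) \<or>
      (\<forall>k\<in>W. recon_normal \<sigma> \<epsilon> a b k = reflect_along (b - a) (n k)))"

text \<open>Walls \<open>i\<close> and \<open>j\<close> alone determine the step. The norm equation
  and the equations of the other walls are the excess conditions that expose a wrong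
  labelling.\<close>

definition consistent ::
  "('b \<Rightarrow> 'b) \<Rightarrow> ('b \<Rightarrow> 'b) \<Rightarrow> ('b \<Rightarrow> real) \<Rightarrow> 'b \<Rightarrow> 'b \<Rightarrow> real^2 \<Rightarrow> real^2 \<Rightarrow> real^2 \<Rightarrow> bool" where
  "consistent \<sigma> \<tau> \<epsilon> i j a b x \<longleftrightarrow>
     quarter_turn (recon_normal \<sigma> \<epsilon> a b i) \<bullet> recon_normal \<sigma> \<epsilon> a b j \<noteq> 0 \<and>
     norm (recon_step \<sigma> \<tau> \<epsilon> i j a b x) = norm (x - b) \<and>
     (\<forall>k\<in>W. recon_normal \<sigma> \<epsilon> a b k \<bullet> recon_step \<sigma> \<tau> \<epsilon> i j a b x = gap b (\<sigma> k) - gap x (\<tau> k))"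

text \<open>For fixed \<open>a\<close> and \<open>b\<close> the reconstructed normals are constant,
  so \<open>consistent\<close> only constrains \<open>u = x - b\<close>. Each of its equations fails
  almost everywhere or holds identically, and the identities force \<open>genuine\<close>.\<close>

lemma AE_consistent_imp_genuine:
  assumes "a \<noteq> b" and inj: "inj_on (gap b) W" and rigid: "rigid_for a b \<sigma>"
    and \<sigma>: "\<sigma> \<in> W \<rightarrow> W" and \<tau>: "\<tau> \<in> W \<rightarrow> W" and ij: "i \<in> W" "j \<in> W"
  shows "AE x in lborel. consistent \<sigma> \<tau> \<epsilon> i j a b x \<longrightarrow> genuine \<sigma> \<tau> \<epsilon> a b"
proof -
  define m where "m = recon_normal \<sigma> \<epsilon> a b"
  define w where "w = b - a"
  have w: "w \<noteq> 0" using assms(1) by (simp add: w_def)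
  have mw: "m k \<bullet> w = gap a k - gap b (\<sigma> k)" for k
    using inner_unit_with_inner[OF w] by (simp add: m_def recon_normal_def w_def)
  \<comment> \<open>The step splits into a part \<open>A\<close> linear in \<open>u\<close> and a
    constant \<open>d\<close>, which stems from the disagreement \<open>\<delta>\<close> of the two
    labellings at \<open>b\<close>.\<close>
  define A where "A u = cramer2 (m i) (m j) (n (\<tau> i) \<bullet> u) (n (\<tau> j) \<bullet> u)" for u
  define \<delta> where "\<delta> k = gap b (\<sigma> k) - gap b (\<tau> k)" for k
  define d where "d = cramer2 (m i) (m j) (\<delta> i) (\<delta> j)"
  have linA: "linear A"
    by (rule linearI) (simp_all add: A_def inner_add_right cramer2_affine)
  have rhs: "gap b (\<sigma> k) - gap x (\<tau> k) = n (\<tau> k) \<bullet> (x - b) + \<delta> k" for x k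
    by (simp add: \<delta>_def gap_shift[of x _ b])
  have step: "recon_step \<sigma> \<tau> \<epsilon> i j a b x = A (x - b) + d" for x
    by (simp add: recon_step_def rhs cramer2_affine A_def d_def flip: m_def)
  show ?thesis
  proof (cases "quarter_turn (m i) \<bullet> m j = 0")
    case True
    then show ?thesis by (simp add: consistent_def m_def)
  next
    case det: False
    have "(AE u in lborel. \<not> (norm (A u + d) = norm u \<and>
            (\<forall>k\<in>W. m k \<bullet> (A u + d) = n (\<tau> k) \<bullet> u + \<delta> k))) \<or> genuine \<sigma> \<tau> \<epsilon> a b"
    proof (cases "d = 0 \<and> orthogonal_transformation A")
      case False
      then have "AE u in lborel. norm (A u + d) \<noteq> norm u"
        by (rule AE_lborel_norm_affine_neq[OF linA])
      then show ?thesis by (intro disjI1) (erule eventually_mono, blast)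
    next
      case True
      then have d: "d = 0" and orth: "orthogonal_transformation A" by auto
      then have inn: "\<And>x y. A x \<bullet> A y = x \<bullet> y" by (simp add: orthogonal_transformation_def)
      have surj: "\<exists>x. A x = y" for y
        using orthogonal_transformation_surj[OF orth] by (metis surjD)
      show ?thesis
      proof (cases "\<forall>k\<in>W. \<forall>u. m k \<bullet> A u - n (\<tau> k) \<bullet> u = \<delta> k")
        case False
        then obtain k where k: "k \<in> W" "\<not> (\<forall>u. m k \<bullet> A u - n (\<tau> k) \<bullet> u = \<delta> k)" by blast
        have "AE u in lborel. m k \<bullet> A u - n (\<tau> k) \<bullet> u \<noteq> \<delta> k"
          by (rule AE_lborel_linear_neq[OF _ k(2)], rule linearI)
            (simp_all add: linear_add[OF linA] linear_cmul[OF linA] inner_add_right algebra_simps)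
        then show ?thesis
          by (intro disjI1) (erule eventually_mono, use k(1) d in force)
      next
        case True
        \<comment> \<open>Evaluation at \<open>u = 0\<close> isolates the constant; equal gaps at
          \<open>b\<close> then mean equal labels.\<close>
        have \<delta>: "\<delta> k = 0" if "k \<in> W" for k
          using True[rule_format, OF that, of 0] by (simp add: linear_0[OF linA])
        then have \<tau>\<sigma>: "\<tau> k = \<sigma> k" if "k \<in> W" for k
          using that inj \<sigma> \<tau> by (auto simp: \<delta>_def inj_on_def Pi_iff)
        have mA: "m k \<bullet> A u = n (\<sigma> k) \<bullet> u" if "k \<in> W" for k u
          using True[rule_format, OF that, of u] \<delta>[OF that] \<tau>\<sigma>[OF that] by simp
        have m: "m k = A (n (\<sigma> k))" if "k \<in> W" for k
        proof -
          have "m k \<bullet> y = A (n (\<sigma> k)) \<bullet> y" for y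
            using surj[of y] mA[OF that] inn by auto
          then show ?thesis by (metis vector_eq_rdot)
        qed
        \<comment> \<open>\<open>A y\<close> is orthogonal to the independent vectors
          \<open>m i\<close> and \<open>m j\<close>, and \<open>A\<close> is isometric. This
          supplies the spanning premise of \<open>rigid_for\<close>.\<close>
        have span: "y = 0" if y: "\<forall>k\<in>W. n (\<sigma> k) \<bullet> y = 0" for y
        proof -
          have "A y = cramer2 (m i) (m j) 0 0"
            using y mA ij by (intro cramer2_unique[OF det]) auto
          then have "A y = 0" by (simp add: cramer2_def)
          then have "y \<bullet> y = 0" using inn[of y y] by simp
          then show ?thesis by simp
        qed
        obtain w0 where w0: "A w0 = w" using surj by blast
        \<comment> \<open>Both \<open>n (\<sigma> k) \<bullet> w0\<close> and
          \<open>n (\<sigma> k) \<bullet> w\<close> contain \<open>gap b (\<sigma> k)\<close>; it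
          cancels in the difference, leaving data at \<open>a\<close> only.\<close>
        have z: "n (\<sigma> k) \<bullet> (w0 - w) = gap a k - gap a (\<sigma> k)" if "k \<in> W" for k
          using mA[OF that, of w0] mw[of k] w0 gap_shift[of b "\<sigma> k" a]
          by (simp add: inner_diff_right w_def)
        have "norm (b - a + (w0 - w)) = norm (b - a)"
          using w0 inn[of w0 w0] by (simp add: w_def norm_eq)
        then have id: "\<sigma> k = k" if "k \<in> W" for k
          using rigid[unfolded rigid_for_def, rule_format, OF span _ z] that by blast
        have "w0 - w = 0"
          by (rule n_span) (use z id in auto)
        then have "A w = w" using w0 by simp
        from orthogonal_transformation_2_fixing[OF orth this w]
        have "(\<forall>k\<in>W. m k = n k) \<or> (\<forall>k\<in>W. m k = reflect_along w (n k))"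
          using m id by auto
        then show ?thesis using id \<tau>\<sigma> by (simp add: genuine_def m_def w_def)
      qed
    qed
    then show ?thesis
    proof
      assume "AE u in lborel. \<not> (norm (A u + d) = norm u \<and>
            (\<forall>k\<in>W. m k \<bullet> (A u + d) = n (\<tau> k) \<bullet> u + \<delta> k))"
      from AE_lborel_translate[OF this, of b] show ?thesis
        by (rule eventually_mono) (auto simp: consistent_def step rhs simp flip: m_def)
    qed simp
  qed
qed

section \<open>Measurability and almost sure genericity\<close>

lemma measurable_gap [measurable (raw)]:
  assumes [measurable]: "f \<in> borel_measurable M"
  shows "(\<lambda>x. gap (f x) k) \<in> borel_measurable M"
  unfolding gap_def by measurable

lemma measurable_recon_normal [measurable (raw)]:
  assumes [measurable]: "a \<in> borel_measurable M" "b \<in> borel_measurable M"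
  shows "(\<lambda>p. recon_normal \<sigma> \<epsilon> (a p) (b p) k) \<in> borel_measurable M"
  unfolding recon_normal_def by measurable

lemma measurable_recon_step [measurable (raw)]:
  assumes [measurable]: "a \<in> borel_measurable M" "b \<in> borel_measurable M" "x \<in> borel_measurable M"
  shows "(\<lambda>p. recon_step \<sigma> \<tau> \<epsilon> i j (a p) (b p) (x p)) \<in> borel_measurable M"
  unfolding recon_step_def by measurable

lemma pred_consistent [measurable (raw)]:
  assumes [measurable]: "a \<in> borel_measurable M" "b \<in> borel_measurable M" "x \<in> borel_measurable M"
  shows "Measurable.pred M (\<lambda>p. consistent \<sigma> \<tau> \<epsilon> i j (a p) (b p) (x p))"
proof -
  have "Measurable.pred M (\<lambda>p. \<forall>k\<in>W. recon_normal \<sigma> \<epsilon> (a p) (b p) k \<bullet>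
      recon_step \<sigma> \<tau> \<epsilon> i j (a p) (b p) (x p) = gap (b p) (\<sigma> k) - gap (x p) (\<tau> k))"
    by (rule pred_intros_finite(3)[OF finite_W]) measurable
  then show ?thesis unfolding consistent_def by measurable
qed

lemma pred_genuine [measurable (raw)]:
  assumes [measurable]: "a \<in> borel_measurable M" "b \<in> borel_measurable M"
  shows "Measurable.pred M (\<lambda>p. genuine \<sigma> \<tau> \<epsilon> (a p) (b p))"
proof -
  have "Measurable.pred M (\<lambda>p. \<forall>k\<in>W. recon_normal \<sigma> \<epsilon> (a p) (b p) k = n k)"
    by (rule pred_intros_finite(3)[OF finite_W], rule pred_eq; measurable)
  moreover have "Measurable.pred M (\<lambda>p. \<forall>k\<in>W.
      recon_normal \<sigma> \<epsilon> (a p) (b p) k = reflect_along (b p - a p) (n k))"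
    by (rule pred_intros_finite(3)[OF finite_W], rule pred_eq; measurable)
  ultimately show ?thesis unfolding genuine_def by measurable
qed

lemma pred_inj_on_gap [measurable (raw)]:
  assumes [measurable]: "a \<in> borel_measurable M"
  shows "Measurable.pred M (\<lambda>p. inj_on (gap (a p)) W)"
  unfolding inj_on_def by (intro pred_intros_finite(3)[OF finite_W]) measurable

text \<open>Only data of the given room occur, so no competing room has to be quantified under the
  almost-everywhere statement. Extensional functions keep the labellings and signs finite in
  number.\<close>

definition generic :: "(real^2) \<times> (real^2) \<times> (real^2) \<Rightarrow> bool" where
  "generic p \<longleftrightarrow> (case p of (a, b, x) \<Rightarrow>
     a \<noteq> b \<and> inj_on (gap a) W \<and>
     (\<forall>\<sigma>\<in>W \<rightarrow>\<^sub>E W. \<forall>\<tau>\<in>W \<rightarrow>\<^sub>E W. \<forall>\<epsilon>\<in>W \<rightarrow>\<^sub>E {1, -1}. \<forall>i\<in>W. \<forall>j\<in>W.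
        consistent \<sigma> \<tau> \<epsilon> i j a b x \<longrightarrow> genuine \<sigma> \<tau> \<epsilon> a b))"

lemma pred_generic: "Measurable.pred borel generic"
proof -
  define N where "N = (borel :: (real^2) measure) \<Otimes>\<^sub>M ((borel :: (real^2) measure) \<Otimes>\<^sub>M (borel :: (real^2) measure))"
  have fin: "finite (W \<rightarrow>\<^sub>E W)" "finite (W \<rightarrow>\<^sub>E {1, -1 :: real})"
    by (simp_all add: finite_PiE finite_W)
  have [measurable]: "fst \<in> borel_measurable N" "(\<lambda>p. fst (snd p)) \<in> borel_measurable N"
    "(\<lambda>p. snd (snd p)) \<in> borel_measurable N" by (simp_all add: N_def)
  have "Measurable.pred N (\<lambda>p. \<forall>\<sigma>\<in>W \<rightarrow>\<^sub>E W. \<forall>\<tau>\<in>W \<rightarrow>\<^sub>E W. \<forall>\<epsilon>\<in>W \<rightarrow>\<^sub>E {1, -1}. \<forall>i\<in>W. \<forall>j\<in>W.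
      consistent \<sigma> \<tau> \<epsilon> i j (fst p) (fst (snd p)) (snd (snd p)) \<longrightarrow>
      genuine \<sigma> \<tau> \<epsilon> (fst p) (fst (snd p)))"
    by (intro pred_intros_finite(3)[OF fin(1)] pred_intros_finite(3)[OF fin(2)]
        pred_intros_finite(3)[OF finite_W]) measurable
  then have "Measurable.pred N generic"
    unfolding generic_def case_prod_beta by measurable
  then show ?thesis by (simp add: N_def borel_prod)
qed

text \<open>The points are chosen in turn: \<open>a\<close> with distinct gaps, then
  \<open>b\<close> with distinct gaps and rigid for every labelling, then \<open>x\<close>. Each
  stage discards finitely many null sets.\<close>

lemma AE_generic: "AE p in lborel. generic p"
proof (rule AE_lborel_triple[OF pred_generic])
  have fin: "finite (W \<rightarrow>\<^sub>E W)" "finite (W \<rightarrow>\<^sub>E {1, -1 :: real})"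
    by (simp_all add: finite_PiE finite_W)
  show "AE a in lborel. AE b in lborel. AE x in lborel. generic (a, b, x)"
    using AE_inj_on_gap
  proof eventually_elim
    fix a assume a: "inj_on (gap a) W"
    have "AE b in lborel. \<forall>\<sigma>\<in>W \<rightarrow>\<^sub>E W. rigid_for a b \<sigma>"
      by (intro AE_finite_allI fin AE_rigid_for[OF a]) auto
    with AE_inj_on_gap AE_lborel_singleton[of a]
    show "AE b in lborel. AE x in lborel. generic (a, b, x)"
    proof eventually_elim
      fix b assume b: "inj_on (gap b) W" "b \<noteq> a" "\<forall>\<sigma>\<in>W \<rightarrow>\<^sub>E W. rigid_for a b \<sigma>"
      have "AE x in lborel. \<forall>\<sigma>\<in>W \<rightarrow>\<^sub>E W. \<forall>\<tau>\<in>W \<rightarrow>\<^sub>E W. \<forall>\<epsilon>\<in>W \<rightarrow>\<^sub>E {1, -1}. \<forall>i\<in>W. \<forall>j\<in>W.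
          consistent \<sigma> \<tau> \<epsilon> i j a b x \<longrightarrow> genuine \<sigma> \<tau> \<epsilon> a b"
        by (intro AE_finite_allI fin finite_W AE_consistent_imp_genuine) (use b in auto)
      then show "AE x in lborel. generic (a, b, x)"
        by (rule eventually_mono) (use a b(2) in \<open>auto simp: generic_def\<close>)
    qed
  qed
qed

section \<open>Uniqueness of the room for generic points\<close>

text \<open>Any competing normals and step arise from some choice of labels, signs and two
  independent walls, so they satisfy \<open>consistent\<close>. Genericity identifies the normals,
  and spanning then identifies \<open>v\<close>.\<close>

lemma generic_imp_congruent:
  assumes gen: "generic (a, b, x)"
    and \<sigma>: "\<sigma> \<in> W \<rightarrow> W" and \<tau>: "\<tau> \<in> W \<rightarrow> W"
    and m: "\<And>k. k \<in> W \<Longrightarrow> norm (m k) = 1"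
    and mw: "\<And>k. k \<in> W \<Longrightarrow> m k \<bullet> (b - a) = gap a k - gap b (\<sigma> k)"
    and mv: "\<And>k. k \<in> W \<Longrightarrow> m k \<bullet> v = gap b (\<sigma> k) - gap x (\<tau> k)"
    and v: "norm v = norm (x - b)"
    and m_span: "\<And>z. (\<And>k. k \<in> W \<Longrightarrow> m k \<bullet> z = 0) \<Longrightarrow> z = 0"
  shows "(\<forall>k\<in>W. m k = n k) \<and> v = x - b \<or>
    (\<forall>k\<in>W. m k = reflect_along (b - a) (n k)) \<and> v = reflect_along (b - a) (x - b)"
proof -
  have "a \<noteq> b" using gen by (simp add: generic_def)
  then have w: "b - a \<noteq> 0" by simp
  have "\<exists>s\<in>{1, -1}. m k = unit_with_inner s (gap a k - gap b (\<sigma> k)) (b - a)" if "k \<in> W" for k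
    by (rule unit_with_inner_exhaust[OF w m[OF that] mw[OF that]])
  then obtain \<epsilon>0 where \<epsilon>0: "\<And>k. k \<in> W \<Longrightarrow> \<epsilon>0 k \<in> {1, -1} \<and>
      m k = unit_with_inner (\<epsilon>0 k) (gap a k - gap b (\<sigma> k)) (b - a)" by metis
  \<comment> \<open>Restriction to \<open>W\<close> gives the extensional functions over which
    \<open>generic\<close> quantifies.\<close>
  define \<epsilon> where "\<epsilon> = restrict \<epsilon>0 W"
  define \<sigma>' where "\<sigma>' = restrict \<sigma> W"
  define \<tau>' where "\<tau>' = restrict \<tau> W"
  have mem: "\<epsilon> \<in> W \<rightarrow>\<^sub>E {1, -1}" "\<sigma>' \<in> W \<rightarrow>\<^sub>E W" "\<tau>' \<in> W \<rightarrow>\<^sub>E W"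
    using \<epsilon>0 \<sigma> \<tau> by (auto simp: \<epsilon>_def \<sigma>'_def \<tau>'_def)
  have eq: "\<sigma>' k = \<sigma> k" "\<tau>' k = \<tau> k" "recon_normal \<sigma>' \<epsilon> a b k = m k" if "k \<in> W" for k
    using that \<epsilon>0[OF that] by (simp_all add: \<epsilon>_def \<sigma>'_def \<tau>'_def recon_normal_def)
  have "\<exists>i. i \<in> W"
  proof (rule ccontr)
    assume "\<nexists>i. i \<in> W"
    then have "axis 1 1 = (0 :: real^2)" by (intro n_span) auto
    then show False by (simp add: axis_eq_0_iff)
  qed
  then obtain i where i: "i \<in> W" ..
  \<comment> \<open>Since the \<open>m k\<close> span, some \<open>m j\<close> is not orthogonal to
    this vector, that is, not parallel to \<open>m i\<close>.\<close>
  have "quarter_turn (m i) \<noteq> 0"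
    using m[OF i] by (auto simp: vec_eq_iff forall_2 norm_eq_1 inner_2)
  then obtain j where j: "j \<in> W" "quarter_turn (m i) \<bullet> m j \<noteq> 0"
    using m_span[of "quarter_turn (m i)"] by (auto simp: inner_commute)
  have step: "recon_step \<sigma>' \<tau>' \<epsilon> i j a b x = v"
    unfolding recon_step_def eq[OF i] eq[OF j(1)]
    by (rule cramer2_unique[OF j(2) mv[OF i] mv[OF j(1)], symmetric])
  have "consistent \<sigma>' \<tau>' \<epsilon> i j a b x"
    using i j eq mv v by (simp add: consistent_def step)
  then have "genuine \<sigma>' \<tau>' \<epsilon> a b"
    using gen mem i j(1) unfolding generic_def by blast
  then have id: "\<And>k. k \<in> W \<Longrightarrow> \<sigma> k = k" "\<And>k. k \<in> W \<Longrightarrow> \<tau> k = k"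
    and cases: "(\<forall>k\<in>W. m k = n k) \<or> (\<forall>k\<in>W. m k = reflect_along (b - a) (n k))"
    using eq by (auto simp: genuine_def)
  have mv': "m k \<bullet> v = n k \<bullet> (x - b)" if "k \<in> W" for k
    using mv[OF that] id that by (simp add: gap_shift[of x k b])
  from cases show ?thesis
  proof
    assume mn: "\<forall>k\<in>W. m k = n k"
    have "v - (x - b) = 0"
      by (rule n_span) (use mv' mn in \<open>simp add: inner_diff_right\<close>)
    with mn show ?thesis by simp
  next
    assume mn: "\<forall>k\<in>W. m k = reflect_along (b - a) (n k)"
    have "reflect_along (b - a) v - (x - b) = 0"
    proof (rule n_span)
      fix k assume "k \<in> W"
      then show "n k \<bullet> (reflect_along (b - a) v - (x - b)) = 0"
        using mv'[of k] mn by (simp add: inner_diff_right reflect_along_inner)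
    qed
    then have "v = reflect_along (b - a) (x - b)"
      by (metis eq_iff_diff_eq_0 reflect_along_involution)
    with mn show ?thesis by simp
  qed
qed

lemma halfspaces_eq_gap:
  "{z. \<forall>k\<in>W. n k \<bullet> z \<le> c k} = {z. \<forall>k\<in>W. n k \<bullet> (z - a) \<le> gap a k}"
  by (simp add: gap_def inner_diff_right)

text \<open>The gaps at \<open>a\<close> are distinct and serve as names for the walls of both
  rooms. Relative to \<open>a\<close> the offsets are these common gaps, so congruent normals give
  congruent rooms.\<close>

lemma room_determined:
  assumes gen: "generic (a, b, x)"
    and W': "wall_system W' n' c'" and card: "card W' = card W"
    and ga: "wall_system.gap n' c' a ` W' = gap a ` W"
    and gb: "wall_system.gap n' c' b ` W' = gap b ` W"
    and gx: "wall_system.gap n' c' y ` W' = gap x ` W"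
    and dist: "norm (y - b) = norm (x - b)"
  defines "P \<equiv> {z. \<forall>k\<in>W. n k \<bullet> z \<le> c k}" and "P' \<equiv> {z. \<forall>k\<in>W'. n' k \<bullet> z \<le> c' k}"
  shows "(P', y) = (P, x) \<or> (P', y) = (line_reflection a b ` P, line_reflection a b x)"
proof -
  interpret R: wall_system W' n' c' by (rule W')
  have "inj_on (gap a) W" using gen by (simp add: generic_def)
  \<comment> \<open>\<open>W'\<close> has as many elements as \<open>W\<close>, hence as many as its
    own image under the gaps at \<open>a\<close>.\<close>
  then have inj: "inj_on (R.gap a) W'"
    using card ga by (metis R.finite_W card_image eq_card_imp_inj_on)
  have "\<exists>k'\<in>W'. R.gap a k' = gap a k" if "k \<in> W" for k
    using ga that by (metis imageE imageI)
  then obtain \<pi> where \<pi>: "\<And>k. k \<in> W \<Longrightarrow> \<pi> k \<in> W' \<and> R.gap a (\<pi> k) = gap a k" by metis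
  have \<pi>_surj: "\<pi> ` W = W'"
  proof
    show "W' \<subseteq> \<pi> ` W"
    proof
      fix k' assume k': "k' \<in> W'"
      then obtain k where "k \<in> W" "R.gap a k' = gap a k" using ga by (metis imageE imageI)
      then have "k' = \<pi> k" using \<pi> k' by (intro inj_onD[OF inj]) auto
      then show "k' \<in> \<pi> ` W" using \<open>k \<in> W\<close> by simp
    qed
  qed (use \<pi> in auto)
  have "\<exists>l\<in>W. R.gap b (\<pi> k) = gap b l" "\<exists>l\<in>W. R.gap y (\<pi> k) = gap x l" if "k \<in> W" for k
    using gb gx \<pi>[OF that] by (metis imageE imageI)+
  then obtain \<sigma> \<tau> where \<sigma>: "\<And>k. k \<in> W \<Longrightarrow> \<sigma> k \<in> W \<and> R.gap b (\<pi> k) = gap b (\<sigma> k)"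
    and \<tau>: "\<And>k. k \<in> W \<Longrightarrow> \<tau> k \<in> W \<and> R.gap y (\<pi> k) = gap x (\<tau> k)" by metis
  have "(\<forall>k\<in>W. (n' \<circ> \<pi>) k = n k) \<and> y - b = x - b \<or>
    (\<forall>k\<in>W. (n' \<circ> \<pi>) k = reflect_along (b - a) (n k)) \<and> y - b = reflect_along (b - a) (x - b)"
  proof (rule generic_imp_congruent[OF gen])
    show "\<sigma> \<in> W \<rightarrow> W" "\<tau> \<in> W \<rightarrow> W" using \<sigma> \<tau> by auto
    show "norm ((n' \<circ> \<pi>) k) = 1" if "k \<in> W" for k using \<pi>[OF that] R.norm_n by simp
    show "(n' \<circ> \<pi>) k \<bullet> (b - a) = gap a k - gap b (\<sigma> k)" if "k \<in> W" for k
      using \<pi>[OF that] \<sigma>[OF that] R.gap_shift[of b "\<pi> k" a] by simp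
    show "(n' \<circ> \<pi>) k \<bullet> (y - b) = gap b (\<sigma> k) - gap x (\<tau> k)" if "k \<in> W" for k
      using \<tau>[OF that] \<sigma>[OF that] R.gap_shift[of y "\<pi> k" b] by simp
    show "z = 0" if z: "\<And>k. k \<in> W \<Longrightarrow> (n' \<circ> \<pi>) k \<bullet> z = 0" for z
      by (rule R.n_span) (use z \<pi>_surj in auto)
  qed (rule dist)
  moreover have "P' = {z. \<forall>k'\<in>\<pi> ` W. n' k' \<bullet> (z - a) \<le> R.gap a k'}"
    unfolding P'_def R.halfspaces_eq_gap[of a] \<pi>_surj ..
  then have P': "P' = {z. \<forall>k\<in>W. (n' \<circ> \<pi>) k \<bullet> (z - a) \<le> gap a k}"
    using \<pi> by simp
  have P: "P = {z. \<forall>k\<in>W. n k \<bullet> (z - a) \<le> gap a k}"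
    unfolding P_def by (rule halfspaces_eq_gap)
  ultimately show ?thesis
  proof (elim disjE conjE)
    assume "\<forall>k\<in>W. (n' \<circ> \<pi>) k = n k" "y - b = x - b"
    then show ?thesis by (simp add: P P')
  next
    assume m: "\<forall>k\<in>W. (n' \<circ> \<pi>) k = reflect_along (b - a) (n k)"
      and y: "y - b = reflect_along (b - a) (x - b)"
    let ?\<rho> = "line_reflection a b"
    have invol: "?\<rho> (?\<rho> z) = z" for z
      by (simp add: line_reflection_eq reflect_along_involution)
    \<comment> \<open>The linear reflection is self-adjoint and \<open>line_reflection\<close> fixes
      \<open>a\<close>, so it can be moved from the normals to the point.\<close>
    have "z \<in> P' \<longleftrightarrow> ?\<rho> z \<in> P" for z
      using m by (simp add: P P' line_reflection_eq reflect_along_inner)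
    then have "P' = ?\<rho> ` P"
      using invol by (metis (no_types, lifting) image_eqI image_iff subsetI subset_antisym)
    moreover have "reflect_along (b - a) (x - a) = reflect_along (b - a) (x - b) + (b - a)"
      using linear_add[OF linear_reflect_along, of "b - a" "x - b" "b - a"]
      by (simp add: reflect_along_self)
    then have "y = ?\<rho> x"
      using y by (simp add: line_reflection_eq algebra_simps)
    ultimately show ?thesis by simp
  qed
qed

end

section \<open>Polygons as wall systems, and the probabilistic conclusion\<close>

text \<open>Facet half-spaces supply normals and offsets, and boundedness makes the normals span.
  The echo multiset enters through its underlying set.\<close>

lemma convex_polygon_wall_system:
  assumes "convex_polygon K P"
  obtains n c where "wall_system (walls P) n c"
    "P = {z. \<forall>k\<in>walls P. n k \<bullet> z \<le> c k}"
    "\<forall>x\<in>P. set_mset (echoes P x) = wall_system.gap n c x ` walls P"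
proof -
  have P: "polytope P" "aff_dim P = DIM(real^2)"
    using assms by (simp_all add: convex_polygon_def)
  then have poly: "polyhedron P" "bounded P"
    by (simp_all add: polytope_imp_polyhedron polytope_imp_bounded)
  obtain n c where facets: "\<forall>w. w facet_of P \<longrightarrow>
       norm (n w) = 1 \<and> w = P \<inter> {x. n w \<bullet> x = c w} \<and> affine hull w = {x. n w \<bullet> x = c w}"
    and P_eq: "\<forall>x. x \<in> P \<longleftrightarrow> (\<forall>w. w facet_of P \<longrightarrow> n w \<bullet> x \<le> c w)"
    using polyhedron_facet_representation[OF poly(1) P(2)] .
  then have n: "\<And>w. w facet_of P \<Longrightarrow> norm (n w) = 1"
    and w: "\<And>w. w facet_of P \<Longrightarrow> w = P \<inter> {x. n w \<bullet> x = c w}"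
    and hull: "\<And>w. w facet_of P \<Longrightarrow> affine hull w = {x. n w \<bullet> x = c w}"
    by blast+
  have mem: "z \<in> P \<longleftrightarrow> (\<forall>k\<in>walls P. n k \<bullet> z \<le> c k)" for z
    using P_eq unfolding walls_def by blast
  then have P_eq': "P = {z. \<forall>k\<in>walls P. n k \<bullet> z \<le> c k}" by blast
  obtain x0 where x0: "x0 \<in> P" using P(2) by fastforce
  have fin: "finite (walls P)"
    unfolding walls_def by (rule finite_polyhedron_facets[OF poly(1)])
  interpret wall_system "walls P" n c
  proof
    show "norm (n k) = 1" if "k \<in> walls P" for k using that n by (simp add: walls_def)
    show "inj_on (\<lambda>k. (n k, c k)) (walls P)"
    proof (rule inj_onI)
      fix k l assume kl: "k \<in> walls P" "l \<in> walls P" and eq: "(n k, c k) = (n l, c l)"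
      have "k = P \<inter> {x. n k \<bullet> x = c k}" using kl by (intro w) (simp add: walls_def)
      also have "\<dots> = P \<inter> {x. n l \<bullet> x = c l}" using eq by simp
      also have "\<dots> = l" using kl by (intro w[symmetric]) (simp add: walls_def)
      finally show "k = l" .
    qed
    fix z assume z: "\<And>k. k \<in> walls P \<Longrightarrow> n k \<bullet> z = 0"
    show "z = 0"
    proof (rule bounded_halfspaces_normals_span)
      show "bounded {z. \<forall>k\<in>walls P. n k \<bullet> z \<le> c k}"
        unfolding P_eq'[symmetric] by (rule poly(2))
    qed (use x0 mem z in auto)
  qed (rule fin)
  have "set_mset (echoes P x) = gap x ` walls P" if x: "x \<in> P" for x
  proof -
    have "infdist x (affine hull k) = gap x k" if "k \<in> walls P" for k
    proof -
      have k: "k facet_of P" using that by (simp add: walls_def)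
      have "n k \<bullet> x \<le> c k" using x that mem by blast
      then show ?thesis
        unfolding hull[OF k] gap_def by (rule infdist_hyperplane_of_le[OF n[OF k]])
    qed
    then show ?thesis by (simp add: echoes_def fin)
  qed
  with that[OF wall_system_axioms P_eq'] show thesis by blast
qed

theorem mainTheorem1:
  fixes K :: nat and P :: "(real^2) set"
    and M :: "'a measure" and O\<^sub>1 O\<^sub>2 O\<^sub>3 :: "'a \<Rightarrow> real^2"
  assumes "K \<ge> 3"
    and "convex_polygon K P"
    and "prob_space M"
    and "O\<^sub>1 \<in> borel_measurable M" and "O\<^sub>2 \<in> borel_measurable M" and "O\<^sub>3 \<in> borel_measurable M"
    and "absolutely_continuous lborel (distr M borel (\<lambda>\<omega>. (O\<^sub>1 \<omega>, O\<^sub>2 \<omega>, O\<^sub>3 \<omega>)))"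
    and "AE \<omega> in M. O\<^sub>1 \<omega> \<in> feasible_region P \<and> O\<^sub>2 \<omega> \<in> feasible_region P \<and> O\<^sub>3 \<omega> \<in> feasible_region P"
  shows "AE \<omega> in M. \<forall>(P' :: (real^2) set) (O\<^sub>3' :: real^2).
    convex_polygon K P' \<and>
    O\<^sub>1 \<omega> \<in> feasible_region P' \<and> O\<^sub>2 \<omega> \<in> feasible_region P' \<and> O\<^sub>3' \<in> feasible_region P' \<and>
    dist (O\<^sub>2 \<omega>) O\<^sub>3' = dist (O\<^sub>2 \<omega>) (O\<^sub>3 \<omega>) \<and>
    echoes P' (O\<^sub>1 \<omega>) = echoes P (O\<^sub>1 \<omega>) \<and>
    echoes P' (O\<^sub>2 \<omega>) = echoes P (O\<^sub>2 \<omega>) \<and>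
    echoes P' O\<^sub>3' = echoes P (O\<^sub>3 \<omega>)
    \<longrightarrow> (P', O\<^sub>3') = (P, O\<^sub>3 \<omega>) \<or>
        (P', O\<^sub>3') = (line_reflection (O\<^sub>1 \<omega>) (O\<^sub>2 \<omega>) ` P, line_reflection (O\<^sub>1 \<omega>) (O\<^sub>2 \<omega>) (O\<^sub>3 \<omega>))"
proof -
  have feasible: "x \<in> S" if "x \<in> feasible_region S" for x S
    using that interior_subset by (auto simp: feasible_region_def)
  obtain n c where W: "wall_system (walls P) n c"
    and P: "P = {z. \<forall>k\<in>walls P. n k \<bullet> z \<le> c k}"
    and echoes: "\<forall>x\<in>P. set_mset (echoes P x) = wall_system.gap n c x ` walls P"
    using convex_polygon_wall_system[OF assms(2)] .
  interpret wall_system "walls P" n c by (rule W)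
  have meas: "(\<lambda>\<omega>. (O\<^sub>1 \<omega>, O\<^sub>2 \<omega>, O\<^sub>3 \<omega>)) \<in> borel_measurable M"
    using assms(4-6) by (intro borel_measurable_Pair)
  \<comment> \<open>Absolute continuity carries the Lebesgue-null exceptional set over to the law of
    the three points.\<close>
  have "AE p in distr M borel (\<lambda>\<omega>. (O\<^sub>1 \<omega>, O\<^sub>2 \<omega>, O\<^sub>3 \<omega>)). generic p"
    by (rule absolutely_continuous_AE[OF _ assms(7) AE_generic]) simp
  then have "AE \<omega> in M. generic (O\<^sub>1 \<omega>, O\<^sub>2 \<omega>, O\<^sub>3 \<omega>)"
    by (rule AE_distrD[OF meas])
  with assms(8) show ?thesis
  proof eventually_elim
    fix \<omega>
    assume inP: "O\<^sub>1 \<omega> \<in> feasible_region P \<and> O\<^sub>2 \<omega> \<in> feasible_region P \<and> O\<^sub>3 \<omega> \<in> feasible_region P"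
      and gen: "generic (O\<^sub>1 \<omega>, O\<^sub>2 \<omega>, O\<^sub>3 \<omega>)"
    show "\<forall>P' O\<^sub>3'.
      convex_polygon K P' \<and>
      O\<^sub>1 \<omega> \<in> feasible_region P' \<and> O\<^sub>2 \<omega> \<in> feasible_region P' \<and> O\<^sub>3' \<in> feasible_region P' \<and>
      dist (O\<^sub>2 \<omega>) O\<^sub>3' = dist (O\<^sub>2 \<omega>) (O\<^sub>3 \<omega>) \<and>
      echoes P' (O\<^sub>1 \<omega>) = echoes P (O\<^sub>1 \<omega>) \<and>
      echoes P' (O\<^sub>2 \<omega>) = echoes P (O\<^sub>2 \<omega>) \<and>
      echoes P' O\<^sub>3' = echoes P (O\<^sub>3 \<omega>)
      \<longrightarrow> (P', O\<^sub>3') = (P, O\<^sub>3 \<omega>) \<or>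
          (P', O\<^sub>3') = (line_reflection (O\<^sub>1 \<omega>) (O\<^sub>2 \<omega>) ` P, line_reflection (O\<^sub>1 \<omega>) (O\<^sub>2 \<omega>) (O\<^sub>3 \<omega>))"
    \<comment> \<open>The competitor is introduced after \<open>\<omega>\<close> is fixed, so a
      single exceptional set serves all rooms \<open>P'\<close>.\<close>
    proof (intro allI impI, elim conjE)
      fix P' y
      assume P': "convex_polygon K P'"
        and inP': "O\<^sub>1 \<omega> \<in> feasible_region P'" "O\<^sub>2 \<omega> \<in> feasible_region P'" "y \<in> feasible_region P'"
        and d: "dist (O\<^sub>2 \<omega>) y = dist (O\<^sub>2 \<omega>) (O\<^sub>3 \<omega>)"
        and e: "echoes P' (O\<^sub>1 \<omega>) = echoes P (O\<^sub>1 \<omega>)" "echoes P' (O\<^sub>2 \<omega>) = echoes P (O\<^sub>2 \<omega>)"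
          "echoes P' y = echoes P (O\<^sub>3 \<omega>)"
      obtain n' c' where W': "wall_system (walls P') n' c'"
        and P'_eq: "P' = {z. \<forall>k\<in>walls P'. n' k \<bullet> z \<le> c' k}"
        and echoes': "\<forall>x\<in>P'. set_mset (echoes P' x) = wall_system.gap n' c' x ` walls P'"
        using convex_polygon_wall_system[OF P'] .
      have card: "card (walls P') = card (walls P)"
        using P' assms(2) by (simp add: convex_polygon_def)
      have d': "norm (y - O\<^sub>2 \<omega>) = norm (O\<^sub>3 \<omega> - O\<^sub>2 \<omega>)"
        using d by (simp add: dist_norm norm_minus_commute)
      have gaps: "wall_system.gap n' c' p ` walls P' = gap q ` walls P"
        if "p \<in> feasible_region P'" "q \<in> feasible_region P" "echoes P' p = echoes P q" for p q
        using echoes'[rule_format, OF feasible[OF that(1)]] echoes[rule_format, OF feasible[OF that(2)]]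
          that(3) by simp
      from room_determined[OF gen W' card gaps gaps gaps d'] inP inP' e
      show "(P', y) = (P, O\<^sub>3 \<omega>) \<or>
          (P', y) = (line_reflection (O\<^sub>1 \<omega>) (O\<^sub>2 \<omega>) ` P, line_reflection (O\<^sub>1 \<omega>) (O\<^sub>2 \<omega>) (O\<^sub>3 \<omega>))"
        unfolding P[symmetric] P'_eq[symmetric] by blast
    qed
  qed
qed

end
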